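(* Let $\ell\ge 3$ be an integer. If $\ell$ is not divisible by four, then $c(\ell)=1$.
   Context: For integers $n\ge \ell\ge 3$, let $C(n,\ell)$ denote the maximum number of directed cycles of length $\ell$ in an $n$-vertex tournament (a tournament is an orientation of a complete graph), and let $R(n,\ell)=\frac{(\ell-1)!}{2^{\ell}}\binom{n}{\ell}$, the expected number of directed cycles of length $\ell$ in the random $n$-vertex tournament (each edge oriented in each direction independently with probability $1/2$). Define $c(\ell)=\lim_{n\to\infty} C(n,\ell)/R(n,\ell)$. *)

theory Defs
  imports Complex_Main "Graph_Theory.Pair_Digraph"
begin

locale tournament = pair_digraph +
  assumes orientation:
    "\<lbrakk>u \<in> pverts G; v \<in> pverts G; u \<noteq> v\<rbrakk> \<Longrightarrow> (u, v) \<in> parcs G \<longleftrightarrow> (v, u) \<notin> parcs G"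

text \<open>
  The predicate \<^const>\<open>pre_digraph.cycle\<close> speaks about arc lists with a distinguished starting
  point. Passing to the set of arcs identifies the rotations of such a list, so that every
  directed cycle is counted exactly once, as a subgraph.
\<close>
definition dicycles :: "'a pair_pre_digraph \<Rightarrow> nat \<Rightarrow> 'a rel set" where
  "dicycles G l = {set p |p. pre_digraph.cycle (with_proj G) p \<and> length p = l}"

definition max_dicycles :: "nat \<Rightarrow> nat \<Rightarrow> nat" where
  "max_dicycles n l =
     Max {card (dicycles G l) |G :: nat pair_pre_digraph. tournament G \<and> card (pverts G) = n}"

definition expected_dicycles :: "nat \<Rightarrow> nat \<Rightarrow> real" where
  "expected_dicycles n l = fact (l - 1) / 2 ^ l * real (n choose l)"

definition dicycle_ratio :: "nat \<Rightarrow> nat \<Rightarrow> real" where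
  "dicycle_ratio l n = real (max_dicycles n l) / expected_dicycles n l"

definition cycle_limit :: "nat \<Rightarrow> real" where
  "cycle_limit l = lim (dicycle_ratio l)"

text \<open>The maximum in \<^const>\<open>max_dicycles\<close> ranges over a finite nonempty set.\<close>

lemma (in tournament) dicycles_subset: "dicycles G l \<subseteq> Pow (parcs G)"
  unfolding dicycles_def pre_digraph.cycle_def pre_digraph.awalk_def by auto

lemma (in tournament) card_dicycles_le: "card (dicycles G l) \<le> 2 ^ (card (pverts G) * card (pverts G))"
proof -
  have sub: "parcs G \<subseteq> pverts G \<times> pverts G"
    using in_arcsD1 in_arcsD2 by auto
  have fin: "finite (pverts G \<times> pverts G)"
    using pair_finite_verts by simp
  have "dicycles G l \<subseteq> Pow (pverts G \<times> pverts G)"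
    using dicycles_subset sub by blast
  hence "card (dicycles G l) \<le> card (Pow (pverts G \<times> pverts G))"
    using fin by (intro card_mono) auto
  also have "\<dots> = 2 ^ (card (pverts G) * card (pverts G))"
    using fin by (simp add: card_Pow card_cartesian_product)
  finally show ?thesis .
qed

lemma finite_dicycle_counts:
  "finite {card (dicycles G l) |G :: 'a pair_pre_digraph. tournament G \<and> card (pverts G) = n}"
proof (rule finite_subset)
  show "{card (dicycles G l) |G :: 'a pair_pre_digraph. tournament G \<and> card (pverts G) = n}
    \<subseteq> {..2 ^ (n * n)}"
    using tournament.card_dicycles_le by fastforce
qed simp

lemma transitive_tournament:
  "tournament \<lparr>pverts = {..<n :: nat}, parcs = {(u, v). u < v \<and> v < n}\<rparr>"
proof
  have "{(u, v). u < v \<and> v < n} \<subseteq> {..<n} \<times> {..<n}" by auto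
  thus "finite (parcs \<lparr>pverts = {..<n}, parcs = {(u, v). u < v \<and> v < n}\<rparr>)"
    by (simp add: finite_subset)
qed auto

lemma dicycle_counts_nonempty:
  "{card (dicycles G l) |G :: nat pair_pre_digraph. tournament G \<and> card (pverts G) = n} \<noteq> {}"
  using transitive_tournament[of n] by fastforce

end

theory Submission
  imports Defs "Jordan_Normal_Form.Schur_Decomposition" "HOL-Real_Asymp.Real_Asymp"
begin

text \<open>
  Upper bound: let \<open>A\<close> be the adjacency matrix of a tournament on \<open>n\<close> vertices with every diagonal
  entry raised to \<open>1/2\<close>, so that \<open>A + A\<^sup>T\<close> is the all-ones matrix. Then every eigenvalue has
  nonnegative real part, the eigenvalues sum to \<open>n/2\<close>, and \<open>l\<close> times the number of \<open>l\<close>-cycles is at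
  most the trace of \<open>A^l\<close>. Since all traces of powers are nonnegative, the spectral radius \<open>r\<close> is
  itself an eigenvalue. If \<open>4\<close> does not divide \<open>l\<close>, then \<open>Re (z^l) \<le> l \<bar>z\<bar>^(l-1) Re z\<close> whenever
  \<open>Re z \<ge> 0\<close>, so the trace is at most \<open>r^l + l r^(l-1) (n/2 - r) \<le> (n/2)^l\<close>.

  Lower bound: average the number of \<open>l\<close>-cycles over all tournaments on \<open>n\<close> vertices.
\<close>

section \<open>Power sums of numbers with nonnegative real part\<close>

text \<open>Each increase of the angle by \<open>2 * t\<close> adds at most
  \<open>\<bar>sin (2 * t)\<bar>\<close>, which is at most
  \<open>2 * \<bar>cos t\<bar>\<close>.\<close>

lemma abs_cos_odd_mult_le: "\<bar>cos (real (2 * m + 1) * t)\<bar> \<le> real (2 * m + 1) * \<bar>cos t\<bar>"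
proof (induction m)
  case (Suc m)
  let ?u = "real (2 * m + 1) * t"
  have "cos (real (2 * Suc m + 1) * t) = cos (?u + 2 * t)"
    by (simp add: algebra_simps)
  also have "\<dots> = cos ?u * cos (2 * t) - sin ?u * (2 * sin t * cos t)"
    by (simp only: cos_add sin_double)
  finally have eq: "cos (real (2 * Suc m + 1) * t) = cos ?u * cos (2 * t) - sin ?u * (2 * sin t * cos t)" .
  have "\<bar>cos ?u * cos (2 * t)\<bar> \<le> \<bar>cos ?u\<bar> * 1"
    unfolding abs_mult by (intro mult_left_mono) auto
  moreover have "\<bar>sin ?u * (2 * sin t * cos t)\<bar> \<le> 1 * (2 * 1 * \<bar>cos t\<bar>)"
    unfolding abs_mult by (intro mult_mono) auto
  ultimately have "\<bar>cos (real (2 * Suc m + 1) * t)\<bar> \<le> \<bar>cos ?u\<bar> + 2 * \<bar>cos t\<bar>"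
    unfolding eq by linarith
  with Suc.IH show ?case
    by (simp add: algebra_simps)
qed simp

text \<open>This is where divisibility by four matters: at \<open>t = pi / 2\<close> the right side
  is 0, while the left side is 1 if 4 divides \<open>l\<close>. Odd \<open>l\<close> follows from
  the previous bound; if \<open>l = 2 * k\<close> with \<open>k\<close> odd, doubling costs nothing
  because 2 c^2 - 1 \<le> c for c in [0, 1].\<close>

lemma cos_mult_le:
  assumes "\<not> 4 dvd l" and "cos t \<ge> 0"
  shows "cos (real l * t) \<le> real l * cos t"
proof (cases "odd l")
  case True
  then obtain m where "l = 2 * m + 1" by (elim oddE)
  with abs_cos_odd_mult_le[of m t] assms show ?thesis by auto
next
  case False
  then obtain k where k: "l = 2 * k" by blast
  with assms have "odd k" by auto
  then obtain m where m: "k = 2 * m + 1" by (elim oddE)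
  let ?c = "\<bar>cos (real k * t)\<bar>"
  have "cos (real l * t) = 2 * ?c\<^sup>2 - 1"
    using cos_double_cos[of "real k * t"] by (simp add: k mult.assoc)
  also have "\<dots> \<le> ?c"
  proof -
    have "(2 * ?c + 1) * (?c - 1) \<le> 0"
      by (intro mult_nonneg_nonpos) auto
    thus ?thesis by (simp add: power2_eq_square algebra_simps)
  qed
  also have "\<dots> \<le> real k * cos t"
    using abs_cos_odd_mult_le[of m t] assms unfolding m by simp
  also have "\<dots> \<le> real l * cos t"
    using assms k by (intro mult_right_mono) auto
  finally show ?thesis .
qed

lemma Re_power_le:
  assumes "\<not> 4 dvd l" and "Re z \<ge> 0"
  shows "Re (z ^ l) \<le> real l * cmod z ^ (l - 1) * Re z"
proof (cases "z = 0")
  case True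
  then show ?thesis using assms by (cases l) auto
next
  case False
  \<comment> \<open>\<open>l = 0\<close> is excluded since 4 divides 0, so the truncated
    \<open>l - 1\<close> is a true predecessor.\<close>
  from assms obtain m where l: "l = Suc m" by (cases l) auto
  define t where "t = Arg z"
  have z: "z = rcis (cmod z) t"
    by (simp add: t_def rcis_cmod_Arg)
  have Re: "Re z = cmod z * cos t"
    by (subst z) simp
  have "cos t \<ge> 0"
    using assms(2) False unfolding Re by (simp add: zero_le_mult_iff)
  hence "cmod z ^ l * cos (real l * t) \<le> cmod z ^ l * (real l * cos t)"
    using assms(1) by (intro mult_left_mono cos_mult_le) auto
  moreover have "Re (z ^ l) = cmod z ^ l * cos (real l * t)"
    by (subst z) (simp add: DeMoivre2)
  ultimately show ?thesis
    by (simp add: Re l mult_ac)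
qed

lemma power_add_ge_tangent:
  fixes x d :: real
  assumes "x \<ge> 0" "d \<ge> 0"
  shows "x ^ l + real l * x ^ (l - 1) * d \<le> (x + d) ^ l"
proof (induction l)
  case (Suc l)
  have "x ^ Suc l + real (Suc l) * x ^ (Suc l - 1) * d \<le> (x ^ l + real l * x ^ (l - 1) * d) * (x + d)"
    using assms by (cases l) (auto simp: algebra_simps)
  also have "\<dots> \<le> (x + d) ^ l * (x + d)"
    using Suc.IH assms by (intro mult_right_mono) auto
  finally show ?case by (simp add: mult.commute)
qed simp

text \<open>The factor 1 - x detects simple poles: in a sum of geometric series, exactly the terms
  with a pole at x = 1 survive, each contributing 1.\<close>

lemma tendsto_pole_at_1:
  fixes u :: complex
  shows "((\<lambda>x. of_real (1 - x) / (1 - u * of_real x)) \<longlongrightarrow> (if u = 1 then 1 else 0)) (at_left (1::real))"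
proof (cases "u = 1")
  case True
  have "\<forall>\<^sub>F x in at_left (1::real). 1 = of_real (1 - x) / (1 - u * of_real x)"
    unfolding eventually_at_filter using True by (intro always_eventually) auto
  thus ?thesis using True by (auto intro: Lim_transform_eventually[OF tendsto_const])
next
  case False
  have "((\<lambda>x. of_real (1 - x) / (1 - u * of_real x)) \<longlongrightarrow> of_real (1 - 1) / (1 - u * of_real 1)) (at_left (1::real))"
    using False by (intro tendsto_intros) auto
  thus ?thesis using False by simp
qed

text \<open>
  Pringsheim's argument: the generating function of the power sums has nonnegative coefficients,
  hence grows at least as fast towards \<open>1\<close> as towards any other point of the unit circle.
\<close>
lemma power_sums_nonneg_imp_unit:
  fixes z :: "'a \<Rightarrow> complex" and p :: "nat \<Rightarrow> real"
  assumes fin: "finite I" and p: "\<And>k. (\<Sum>i\<in>I. z i ^ k) = of_real (p k)" "\<And>k. p k \<ge> 0"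
    and z: "\<And>i. i \<in> I \<Longrightarrow> cmod (z i) \<le> 1" and j: "j \<in> I" "cmod (z j) = 1"
  shows "\<exists>i\<in>I. z i = 1"
proof -
  \<comment> \<open>Closed form of the generating function of the power sums; its pole from
    \<open>z j\<close> lies at the inverse of \<open>z j\<close>.\<close>
  define F where "F w = (\<Sum>i\<in>I. 1 / (1 - z i * w))" for w
  have F: "(\<lambda>k. of_real (p k) * w ^ k) sums F w" if "cmod w < 1" for w
  proof -
    have "(\<lambda>k. \<Sum>i\<in>I. (z i * w) ^ k) sums F w"
      unfolding F_def
    proof (intro sums_sum geometric_sums)
      fix i assume "i \<in> I"
      have "cmod (z i * w) \<le> 1 * cmod w"
        unfolding norm_mult using z[OF \<open>i \<in> I\<close>] by (intro mult_right_mono) auto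
      thus "cmod (z i * w) < 1" using that by simp
    qed
    thus ?thesis by (simp add: power_mult_distrib flip: sum_distrib_right p(1))
  qed
  \<comment> \<open>On the unit circle the conjugate is the inverse, so the ray through
    \<open>u\<close> runs into the pole coming from \<open>z j\<close>.\<close>
  define u where "u = cnj (z j)"
  have u: "cmod u = 1" "z j * u = 1"
    using j by (auto simp: u_def complex_mult_cnj cmod_def simp flip: of_real_add)
  \<comment> \<open>Triangle inequality: \<open>u\<close> has modulus 1 and the coefficients
    \<open>p k\<close> are nonnegative.\<close>
  have le: "cmod (F (u * of_real x)) \<le> Re (F (of_real x))" if "0 \<le> x" "x < 1" for x
  proof -
    have "(\<lambda>k. Re (of_real (p k) * of_real x ^ k)) sums Re (F (of_real x))"
      using that by (intro sums_Re F) auto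
    hence s: "(\<lambda>k. p k * x ^ k) sums Re (F (of_real x))"
      by (simp flip: of_real_power)
    have "F (u * of_real x) = (\<Sum>k. of_real (p k) * (u * of_real x) ^ k)"
      using that u by (intro sums_unique F) (auto simp: norm_mult)
    also have "cmod \<dots> \<le> (\<Sum>k. p k * x ^ k)"
      using s that u p(2) by (intro norm_suminf_le sums_summable[OF s])
        (auto simp: norm_mult norm_power)
    also have "\<dots> = Re (F (of_real x))"
      using s by (simp add: sums_iff)
    finally show ?thesis .
  qed
  \<comment> \<open>The limit counts the \<open>z i\<close> equal to the inverse of
    \<open>v\<close>. Comparing \<open>v = u\<close> with \<open>v = 1\<close> shows that 1 occurs
    at least as often as \<open>z j\<close>, hence at least once.\<close>
  have lim: "((\<lambda>x. of_real (1 - x) * F (v * of_real x)) \<longlongrightarrow> of_nat (card {i \<in> I. z i * v = 1})) (at_left (1::real))" for v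
  proof -
    have "((\<lambda>x. \<Sum>i\<in>I. of_real (1 - x) / (1 - z i * v * of_real x)) \<longlongrightarrow>
        (\<Sum>i\<in>I. if z i * v = 1 then 1 else 0)) (at_left (1::real))"
      by (intro tendsto_sum tendsto_pole_at_1)
    thus ?thesis
      using fin by (simp add: F_def sum_distrib_left mult.assoc sum.If_cases Int_def)
  qed
  have "((\<lambda>x. Re (of_real (1 - x) * F (1 * of_real x))) \<longlongrightarrow> Re (of_nat (card {i \<in> I. z i * 1 = 1}))) (at_left (1::real))"
    by (intro tendsto_Re lim)
  moreover have "((\<lambda>x. cmod (of_real (1 - x) * F (u * of_real x))) \<longlongrightarrow> cmod (of_nat (card {i \<in> I. z i * u = 1}))) (at_left (1::real))"
    by (intro tendsto_norm lim)
  moreover have "\<forall>\<^sub>F x in at_left (1::real). cmod (of_real (1 - x) * F (u * of_real x)) \<le> Re (of_real (1 - x) * F (1 * of_real x))"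
  proof -
    have "\<forall>\<^sub>F x in at_left (1::real). x \<in> {0<..<1}"
      by (intro eventually_at_left_real) auto
    thus ?thesis
    proof eventually_elim
      case (elim x)
      have "(1 - x) * cmod (F (u * of_real x)) \<le> (1 - x) * Re (F (of_real x))"
        using elim by (intro mult_left_mono le) auto
      thus ?case using elim by (simp add: norm_mult del: of_real_diff)
    qed
  qed
  ultimately have "cmod (of_nat (card {i \<in> I. z i * u = 1})) \<le> Re (of_nat (card {i \<in> I. z i * 1 = 1}))"
    by (rule tendsto_le[OF trivial_limit_at_left_real])
  hence "card {i \<in> I. z i * u = 1} \<le> card {i \<in> I. z i = 1}" by simp
  moreover have "card {i \<in> I. z i * u = 1} > 0"
    using fin j u by (subst card_gt_0_iff) auto
  ultimately have "{i \<in> I. z i = 1} \<noteq> {}" by (metis card.empty not_le)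
  thus ?thesis by blast
qed

text \<open>Dividing by the largest modulus \<open>r\<close> reduces this to the unit disc and keeps
  the power sums nonnegative; if \<open>r = 0\<close>, any index attaining the maximum already has
  value 0.\<close>

lemma max_norm_in_spectrum:
  fixes e :: "'a \<Rightarrow> complex" and p :: "nat \<Rightarrow> real"
  assumes fin: "finite I" "I \<noteq> {}" and p: "\<And>k. (\<Sum>i\<in>I. e i ^ k) = of_real (p k)" "\<And>k. p k \<ge> 0"
  obtains i where "i \<in> I" "e i = of_real (cmod (e i))" "\<And>j. j \<in> I \<Longrightarrow> cmod (e j) \<le> cmod (e i)"
proof -
  define r where "r = Max ((\<lambda>i. cmod (e i)) ` I)"
  have le: "cmod (e j) \<le> r" if "j \<in> I" for j
    using fin that by (auto simp: r_def)
  have "r \<in> (\<lambda>i. cmod (e i)) ` I"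
    unfolding r_def using fin by (intro Max_in) auto
  then obtain m where m: "m \<in> I" "cmod (e m) = r" by auto
  have "\<exists>i\<in>I. e i = of_real r"
  proof (cases "r = 0")
    case True
    thus ?thesis using m by (intro bexI[of _ m]) auto
  next
    case False
    hence r: "r > 0" using m by (metis norm_ge_zero order_le_less)
    have "\<exists>i\<in>I. e i / of_real r = 1"
    proof (rule power_sums_nonneg_imp_unit[where p = "\<lambda>k. p k / r ^ k" and j = m])
      show "(\<Sum>i\<in>I. (e i / of_real r) ^ k) = of_real (p k / r ^ k)" for k
        by (simp add: power_divide p(1) flip: sum_divide_distrib)
    qed (use fin p m r le in \<open>auto simp: norm_divide\<close>)
    thus ?thesis using False by auto
  qed
  then obtain i where "i \<in> I" "e i = of_real r" by blast
  moreover have "r \<ge> 0" using m by auto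
  ultimately show thesis using le by (intro that[of i]) auto
qed

text \<open>The dominant value \<open>r\<close> is split off as a real number. The other terms are
  bounded linearly in their real parts, whose sum is \<open>d\<close>, and the tangent bound at
  \<open>r\<close> absorbs them into the power of \<open>r + d\<close>.\<close>

lemma power_sum_le_power_of_sum:
  fixes e :: "'a \<Rightarrow> complex" and p :: "nat \<Rightarrow> real"
  assumes fin: "finite I" "I \<noteq> {}" and p: "\<And>k. (\<Sum>i\<in>I. e i ^ k) = of_real (p k)" "\<And>k. p k \<ge> 0"
    and Re: "\<And>i. i \<in> I \<Longrightarrow> Re (e i) \<ge> 0" and l: "\<not> 4 dvd l"
  shows "p l \<le> p 1 ^ l"
proof -
  obtain m where m: "m \<in> I" "e m = of_real (cmod (e m))" "\<And>j. j \<in> I \<Longrightarrow> cmod (e j) \<le> cmod (e m)"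
    using max_norm_in_spectrum[OF fin p] by blast
  define r where "r = cmod (e m)"
  define d where "d = (\<Sum>i\<in>I - {m}. Re (e i))"
  have em: "e m = of_real r" using m by (simp add: r_def)
  have pk: "p k = r ^ k + (\<Sum>i\<in>I - {m}. Re (e i ^ k))" for k
  proof -
    have "p k = Re (\<Sum>i\<in>I. e i ^ k)" by (simp add: p(1))
    also have "\<dots> = Re (e m ^ k) + (\<Sum>i\<in>I - {m}. Re (e i ^ k))"
      using fin m by (simp add: sum.remove)
    finally show ?thesis by (simp add: em flip: of_real_power)
  qed
  have "p l \<le> r ^ l + (\<Sum>i\<in>I - {m}. real l * r ^ (l - 1) * Re (e i))"
    unfolding pk
  proof (intro add_left_mono sum_mono)
    fix i assume i: "i \<in> I - {m}"
    have "Re (e i ^ l) \<le> real l * cmod (e i) ^ (l - 1) * Re (e i)"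
      using i Re l by (intro Re_power_le) auto
    also have "\<dots> \<le> real l * r ^ (l - 1) * Re (e i)"
      using i Re m(3)[of i] by (intro mult_right_mono mult_left_mono power_mono) (auto simp: r_def)
    finally show "Re (e i ^ l) \<le> real l * r ^ (l - 1) * Re (e i)" .
  qed
  also have "\<dots> = r ^ l + real l * r ^ (l - 1) * d"
    by (simp add: d_def sum_distrib_left)
  also have "\<dots> \<le> (r + d) ^ l"
    using Re by (intro power_add_ge_tangent) (auto simp: r_def d_def intro!: sum_nonneg)
  also have "r + d = p 1"
    using pk[of 1] by (simp add: d_def)
  finally show ?thesis .
qed


section \<open>Traces of matrix powers\<close>

lemma mult_mat_entry:
  assumes "A \<in> carrier_mat n m" "B \<in> carrier_mat m r" "i < n" "j < r"
  shows "(A * B) $$ (i, j) = (\<Sum>k<m. A $$ (i, k) * B $$ (k, j))"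
  using assms by (auto simp: scalar_prod_def lessThan_atLeast0 intro!: sum.cong)

definition trace_mat :: "'a :: comm_ring_1 mat \<Rightarrow> 'a" where
  "trace_mat A = (\<Sum>i<dim_row A. A $$ (i, i))"

lemma trace_mat_mult_comm:
  fixes A B :: "'a :: comm_ring_1 mat"
  assumes A: "A \<in> carrier_mat n m" and B: "B \<in> carrier_mat m n"
  shows "trace_mat (A * B) = trace_mat (B * A)"
proof -
  have "trace_mat (A * B) = (\<Sum>i<n. \<Sum>j<m. A $$ (i, j) * B $$ (j, i))"
    using A B by (auto simp: trace_mat_def scalar_prod_def lessThan_atLeast0 intro!: sum.cong)
  also have "\<dots> = (\<Sum>j<m. \<Sum>i<n. B $$ (j, i) * A $$ (i, j))"
    by (subst sum.swap) (simp add: mult.commute)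
  also have "\<dots> = trace_mat (B * A)"
    using A B by (auto simp: trace_mat_def scalar_prod_def lessThan_atLeast0 intro!: sum.cong)
  finally show ?thesis .
qed

lemma upper_triangular_pow:
  fixes T :: "'a :: comm_ring_1 mat"
  assumes T: "T \<in> carrier_mat n n" "upper_triangular T"
  shows "upper_triangular (T ^\<^sub>m k) \<and> (\<forall>i<n. (T ^\<^sub>m k) $$ (i, i) = T $$ (i, i) ^ k)"
proof (induction k)
  case (Suc k)
  let ?U = "T ^\<^sub>m k"
  have U: "?U \<in> carrier_mat n n" using T by simp
  have entry: "(?U * T) $$ (i, j) = (\<Sum>m<n. ?U $$ (i, m) * T $$ (m, j))" if "i < n" "j < n" for i j
    using T U that by (intro mult_mat_entry) auto
  \<comment> \<open>On and below the diagonal, a term needs i \<le> m \<le> j \<le> i to survive,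
    which leaves only \<open>m = i = j\<close>.\<close>
  have zero: "?U $$ (i, m) * T $$ (m, j) = 0" if "i < n" "m < n" "j \<le> i" "m \<noteq> i \<or> j \<noteq> i" for i j m
  proof (cases "m < i")
    case True
    thus ?thesis using Suc that U by (auto dest: upper_triangularD)
  next
    case False
    hence "j < m" using that by auto
    thus ?thesis using T that by (auto dest: upper_triangularD)
  qed
  have "(?U * T) $$ (i, j) = 0" if "j < i" "i < n" for i j
    using that zero by (subst entry) (auto intro!: sum.neutral)
  moreover have "(?U * T) $$ (i, i) = T $$ (i, i) ^ Suc k" if "i < n" for i
  proof -
    have "(?U * T) $$ (i, i) = (\<Sum>m\<in>{i}. ?U $$ (i, m) * T $$ (m, i))"
      unfolding entry[OF that that] using that zero by (intro sum.mono_neutral_right) auto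
    thus ?thesis using Suc that by (simp add: mult.commute)
  qed
  ultimately show ?case using U T by (auto intro!: upper_triangularI)
qed (use T in auto)

text \<open>Schur triangularisation gives \<open>A ^\<^sub>m k = P * T ^\<^sub>m k * Q\<close> with
  \<open>Q * P\<close> the identity, and the cyclic property of the trace removes \<open>P\<close>
  and \<open>Q\<close>. The same family \<open>e\<close>, the diagonal of \<open>T\<close>, serves
  every \<open>k\<close>, as the power-sum argument requires.\<close>

lemma trace_pow_eq_sum_eigenvalues:
  fixes A :: "complex mat"
  assumes A: "A \<in> carrier_mat n n"
  obtains e where "\<And>i. i < n \<Longrightarrow> eigenvalue A (e i)" "\<And>k. trace_mat (A ^\<^sub>m k) = (\<Sum>i<n. e i ^ k)"
proof -
  obtain es where es: "char_poly A = (\<Prod>a\<leftarrow>es. [:- a, 1:])" "length es = n"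
    using char_poly_factorized[OF A] by blast
  obtain T P Q where "schur_decomposition A es = (T, P, Q)"
    by (cases "schur_decomposition A es") auto
  from schur_decomposition[OF A es(1) this]
  have sim: "similar_mat_wit A T P Q" and T: "upper_triangular T" "diag_mat T = es" by auto
  note sD = similar_mat_witD2[OF A sim]
  show thesis
  proof (rule that[of "\<lambda>i. T $$ (i, i)"])
    fix i assume "i < n"
    hence "T $$ (i, i) \<in> set es"
      using sD(5) by (auto simp flip: T(2) simp: diag_mat_def)
    thus "eigenvalue A (T $$ (i, i))"
      unfolding eigenvalue_root_char_poly[OF A] es(1) by (auto simp: poly_prod_list prod_list_zero_iff)
  next
    fix k
    let ?U = "T ^\<^sub>m k"
    have U: "?U \<in> carrier_mat n n" using sD(5) by simp
    have "A ^\<^sub>m k = P * (?U * Q)"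
      using similar_mat_wit_pow_id[OF sim, of k] sD U by (simp add: assoc_mult_mat)
    hence "trace_mat (A ^\<^sub>m k) = trace_mat (?U * Q * P)"
      using trace_mat_mult_comm[of P n n "?U * Q"] sD(6,7) U by simp
    also have "?U * Q * P = ?U"
      using sD U by (simp add: assoc_mult_mat[of _ n n _ n _ n])
    also have "trace_mat ?U = (\<Sum>i<n. T $$ (i, i) ^ k)"
      using upper_triangular_pow[OF sD(5) T(1), of k] sD(5) by (auto simp: trace_mat_def)
    finally show "trace_mat (A ^\<^sub>m k) = (\<Sum>i<n. T $$ (i, i) ^ k)" .
  qed
qed

section \<open>Nonnegative matrices, and matrices whose sum with their transpose is all ones\<close>

lemma pow_mat_nonneg:
  fixes A :: "real mat"
  assumes A: "A \<in> carrier_mat n n" "\<And>i j. i < n \<Longrightarrow> j < n \<Longrightarrow> A $$ (i, j) \<ge> 0"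
  shows "i < n \<Longrightarrow> j < n \<Longrightarrow> (A ^\<^sub>m k) $$ (i, j) \<ge> 0"
proof (induction k arbitrary: i j)
  case (Suc k)
  have "(A ^\<^sub>m k * A) $$ (i, j) = (\<Sum>m<n. (A ^\<^sub>m k) $$ (i, m) * A $$ (m, j))"
    using A Suc.prems by (intro mult_mat_entry) auto
  also have "\<dots> \<ge> 0"
    using A Suc by (intro sum_nonneg mult_nonneg_nonneg) auto
  finally show ?case by simp
qed (use A in auto)

text \<open>For an eigenvector v, pairing \<open>A\<close> + A^T with v on both sides gives 2 Re(e)
  |v|^2. Since \<open>A\<close> + A^T is the all-ones matrix, this equals the squared modulus of the
  sum of the entries of v.\<close>

lemma eigenvalue_Re_nonneg:
  fixes A :: "real mat"
  assumes A: "A \<in> carrier_mat n n" "\<And>i j. i < n \<Longrightarrow> j < n \<Longrightarrow> A $$ (i, j) + A $$ (j, i) = 1"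
    and ev: "eigenvalue (map_mat complex_of_real A) e"
  shows "Re e \<ge> 0"
proof -
  let ?C = "map_mat complex_of_real A"
  obtain v where v: "v \<in> carrier_vec n" "v \<noteq> 0\<^sub>v n" "?C *\<^sub>v v = e \<cdot>\<^sub>v v"
    using ev A by (auto simp: eigenvalue_def eigenvector_def)
  define x where "x i = v $ i" for i
  have row: "(\<Sum>j<n. of_real (A $$ (i, j)) * x j) = e * x i" if "i < n" for i
  proof -
    have "(?C *\<^sub>v v) $ i = row ?C i \<bullet> v"
      using A that by (intro index_mult_mat_vec) auto
    also have "\<dots> = (\<Sum>j<n. of_real (A $$ (i, j)) * x j)"
      using A v that by (auto simp: scalar_prod_def lessThan_atLeast0 x_def intro!: sum.cong)
    finally show ?thesis using v that by (simp add: x_def)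
  qed
  define q where "q = (\<Sum>i<n. \<Sum>j<n. cnj (x i) * of_real (A $$ (i, j)) * x j)"
  define N where "N = (\<Sum>i<n. (cmod (x i))\<^sup>2)"
  have q: "q = e * of_real N"
  proof -
    have "q = (\<Sum>i<n. cnj (x i) * (\<Sum>j<n. of_real (A $$ (i, j)) * x j))"
      by (simp add: q_def sum_distrib_left mult.assoc)
    also have "\<dots> = (\<Sum>i<n. e * (x i * cnj (x i)))"
      by (intro sum.cong refl) (simp add: row)
    finally show ?thesis
      by (simp add: N_def sum_distrib_left complex_norm_square del: of_real_power)
  qed
  have "q + cnj q = (\<Sum>i<n. \<Sum>j<n. cnj (x i) * x j)"
  proof -
    \<comment> \<open>The entries of \<open>A\<close> are real, so conjugation followed by swapping
      the two indices amounts to transposing \<open>A\<close>.\<close>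
    have "cnj q = (\<Sum>i<n. \<Sum>j<n. x j * of_real (A $$ (j, i)) * cnj (x i))"
      unfolding q_def by (subst sum.swap) simp
    hence "q + cnj q = (\<Sum>i<n. \<Sum>j<n. cnj (x i) * of_real (A $$ (i, j)) * x j
        + x j * of_real (A $$ (j, i)) * cnj (x i))"
      by (simp add: q_def sum.distrib)
    also have "\<dots> = (\<Sum>i<n. \<Sum>j<n. cnj (x i) * x j)"
    proof (intro sum.cong refl)
      fix i j assume "i \<in> {..<n}" "j \<in> {..<n}"
      hence "complex_of_real (A $$ (i, j) + A $$ (j, i)) = 1" using A by simp
      hence "cnj (x i) * x j * (complex_of_real (A $$ (i, j)) + of_real (A $$ (j, i))) = cnj (x i) * x j"
        by simp
      thus "cnj (x i) * of_real (A $$ (i, j)) * x j + x j * of_real (A $$ (j, i)) * cnj (x i)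
          = cnj (x i) * x j"
        by (simp add: algebra_simps)
    qed
    finally show ?thesis .
  qed
  also have "\<dots> = cnj (\<Sum>j<n. x j) * (\<Sum>j<n. x j)"
    by (simp add: sum_product)
  finally have "q + cnj q = of_real ((cmod (\<Sum>j<n. x j))\<^sup>2)"
    by (simp only: complex_norm_square mult.commute)
  hence "Re (q + cnj q) \<ge> 0" by simp
  hence "Re e * N \<ge> 0" by (simp add: q mult.commute)
  moreover have "N > 0"
  proof -
    have "\<exists>i<n. x i \<noteq> 0"
    proof (rule ccontr)
      assume "\<not> (\<exists>i<n. x i \<noteq> 0)"
      hence "v = 0\<^sub>v n" using v(1) by (intro eq_vecI) (auto simp: x_def)
      with v(2) show False by simp
    qed
    then obtain i where i: "i < n" "x i \<noteq> 0" by blast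
    have "0 < (cmod (x i))\<^sup>2" using i by simp
    also have "\<dots> \<le> N"
      unfolding N_def using i by (intro member_le_sum) auto
    finally show ?thesis .
  qed
  ultimately show ?thesis by (simp add: zero_le_mult_iff)
qed

lemma trace_pow_le:
  fixes A :: "real mat"
  assumes A: "A \<in> carrier_mat n n" "\<And>i j. i < n \<Longrightarrow> j < n \<Longrightarrow> A $$ (i, j) + A $$ (j, i) = 1"
    and nonneg: "\<And>i j. i < n \<Longrightarrow> j < n \<Longrightarrow> A $$ (i, j) \<ge> 0" and l: "\<not> 4 dvd l"
  shows "trace_mat (A ^\<^sub>m l) \<le> (real n / 2) ^ l"
\<comment> \<open>The empty spectrum has no element of largest modulus, so it is treated
  apart.\<close>
proof (cases "n = 0")
  case True
  then show ?thesis using A by (simp add: trace_mat_def)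
next
  case False
  let ?C = "map_mat complex_of_real A"
  obtain e where e: "\<And>i. i < n \<Longrightarrow> eigenvalue ?C (e i)" "\<And>k. trace_mat (?C ^\<^sub>m k) = (\<Sum>i<n. e i ^ k)"
    using trace_pow_eq_sum_eigenvalues[of ?C n] A by auto
  have tr: "trace_mat (?C ^\<^sub>m k) = of_real (trace_mat (A ^\<^sub>m k))" for k
    using A by (simp add: trace_mat_def flip: of_real_hom.mat_hom_pow[OF A(1)])
  have "trace_mat (A ^\<^sub>m l) \<le> trace_mat (A ^\<^sub>m 1) ^ l"
  proof (rule power_sum_le_power_of_sum[where I = "{..<n}" and e = e])
    show "(\<Sum>i\<in>{..<n}. e i ^ k) = of_real (trace_mat (A ^\<^sub>m k))" for k
      using e(2) tr by simp
    show "trace_mat (A ^\<^sub>m k) \<ge> 0" for k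
      using A pow_mat_nonneg[OF A(1) nonneg] by (auto simp: trace_mat_def intro!: sum_nonneg)
    show "Re (e i) \<ge> 0" if "i \<in> {..<n}" for i
      using that eigenvalue_Re_nonneg[OF A e(1)] by auto
  qed (use False l in auto)
  also have "trace_mat (A ^\<^sub>m 1) = real n / 2"
  proof -
    \<comment> \<open>The case \<open>j = i\<close> of the condition on \<open>A\<close> forces the
      diagonal.\<close>
    have "A $$ (i, i) = 1 / 2" if "i < n" for i
      using A(2)[OF that that] by simp
    hence "(\<Sum>i<n. A $$ (i, i)) = (\<Sum>i<n. 1 / 2)" by (intro sum.cong) auto
    thus ?thesis using A by (simp add: trace_mat_def)
  qed
  finally show ?thesis .
qed


section \<open>Cycles and closed walks\<close>

lemma (in tournament) finite_arc_lists: "finite {p. set p \<subseteq> parcs G \<and> length p = k}"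
  by (intro finite_lists_length_eq) auto

text \<open>Only an inequality is claimed, so that \<open>A\<close> may exceed the adjacency matrix,
  as it will on the diagonal. The induction removes the last arc of a walk.\<close>

lemma (in tournament) card_walks_le_pow:
  fixes f :: "nat \<Rightarrow> 'a" and A :: "real mat"
  assumes f: "bij_betw f {..<n} (pverts G)" and A: "A \<in> carrier_mat n n"
    and nonneg: "\<And>i j. i < n \<Longrightarrow> j < n \<Longrightarrow> A $$ (i, j) \<ge> 0"
    and arc: "\<And>i j. i < n \<Longrightarrow> j < n \<Longrightarrow> (f i, f j) \<in> parcs G \<Longrightarrow> A $$ (i, j) \<ge> 1"
  shows "i < n \<Longrightarrow> j < n \<Longrightarrow> real (card {p. awalk (f i) p (f j) \<and> length p = k}) \<le> (A ^\<^sub>m k) $$ (i, j)"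
proof (induction k arbitrary: j)
  case 0
  have fv: "f i \<in> pverts G" using f 0 by (auto simp: bij_betw_def)
  have "{p. awalk (f i) p (f j) \<and> length p = 0} = (if i = j then {[]} else {})"
    using f 0 fv by (auto simp: awalk_Nil_iff bij_betw_def inj_on_def)
  thus ?case using 0 A by auto
next
  case (Suc k)
  let ?W = "\<lambda>k j. {p. awalk (f i) p (f j) \<and> length p = k}"
  define M where "M = {m. m < n \<and> (f m, f j) \<in> parcs G}"
  have finW: "finite (?W k m)" for k m
    by (rule finite_subset[OF _ finite_arc_lists[of k]]) auto
  have "?W (Suc k) j \<subseteq> (\<Union>m\<in>M. (\<lambda>p. p @ [(f m, f j)]) ` ?W k m)"
  proof
    fix p assume "p \<in> ?W (Suc k) j"
    hence p: "awalk (f i) p (f j)" "length p = Suc k" by auto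
    then obtain q a b where q: "p = q @ [(a, b)]"
      by (cases p rule: rev_cases) auto
    have w: "awalk (f i) q a" "b = f j" "(a, b) \<in> parcs G"
      using p(1) unfolding q by (auto simp: awalk_Cons_iff awalk_Nil_iff)
    have "a \<in> pverts G" using w(3) by (rule in_arcsD1)
    then obtain m where "m < n" "a = f m" using f by (auto simp: bij_betw_def)
    thus "p \<in> (\<Union>m\<in>M. (\<lambda>p. p @ [(f m, f j)]) ` ?W k m)"
      using w p(2) unfolding q M_def by auto
  qed
  hence "card (?W (Suc k) j) \<le> card (\<Union>m\<in>M. (\<lambda>p. p @ [(f m, f j)]) ` ?W k m)"
    using finW by (intro card_mono finite_UN_I) (auto simp: M_def)
  also have "\<dots> \<le> (\<Sum>m\<in>M. card ((\<lambda>p. p @ [(f m, f j)]) ` ?W k m))"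
    by (intro card_UN_le) (auto simp: M_def)
  also have "\<dots> \<le> (\<Sum>m\<in>M. card (?W k m))"
    by (intro sum_mono card_image_le finW)
  finally have "real (card (?W (Suc k) j)) \<le> (\<Sum>m\<in>M. real (card (?W k m)))"
    unfolding of_nat_sum[symmetric] of_nat_le_iff .
  also have "\<dots> \<le> (\<Sum>m\<in>M. (A ^\<^sub>m k) $$ (i, m) * A $$ (m, j))"
  proof (intro sum_mono)
    fix m assume "m \<in> M"
    hence m: "m < n" "A $$ (m, j) \<ge> 1" using arc Suc.prems by (auto simp: M_def)
    have "real (card (?W k m)) * 1 \<le> (A ^\<^sub>m k) $$ (i, m) * A $$ (m, j)"
      using m Suc pow_mat_nonneg[OF A nonneg] by (intro mult_mono) auto
    thus "real (card (?W k m)) \<le> (A ^\<^sub>m k) $$ (i, m) * A $$ (m, j)" by simp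
  qed
  \<comment> \<open>Indices outside \<open>M\<close> contribute nonnegative terms, so the sum may be
    extended to a full matrix product entry.\<close>
  also have "\<dots> \<le> (\<Sum>m<n. (A ^\<^sub>m k) $$ (i, m) * A $$ (m, j))"
    using Suc.prems pow_mat_nonneg[OF A nonneg] nonneg by (intro sum_mono2) (auto simp: M_def)
  also have "\<dots> = (A ^\<^sub>m k * A) $$ (i, j)"
    using A Suc.prems by (intro mult_mat_entry[symmetric]) auto
  finally show ?case by simp
qed

text \<open>Cutting the walk at the rotation point and exchanging the two pieces gives a closed walk
  based at the cut vertex.\<close>

lemma (in tournament) rotate_closed_awalk:
  assumes "awalk u p u"
  shows "\<exists>v. awalk v (rotate k p) v"
proof -
  let ?k = "k mod length p"
  have "awalk u (take ?k p @ drop ?k p) u" using assms by simp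
  then obtain w where "awalk u (take ?k p) w" "awalk w (drop ?k p) u"
    unfolding awalk_append_iff by blast
  hence "awalk w (drop ?k p @ take ?k p) w" by (metis awalk_appendI)
  thus ?thesis unfolding rotate_drop_take by blast
qed

text \<open>Every cycle, being an arc set, yields \<open>l\<close> different closed walks: the
  rotations of one chosen arc list \<open>h c\<close>.\<close>

lemma (in tournament) dicycles_le_closed_walks:
  fixes f :: "nat \<Rightarrow> 'a"
  assumes f: "bij_betw f {..<n} (pverts G)"
  shows "l * card (dicycles G l) \<le> (\<Sum>i<n. card {p. awalk (f i) p (f i) \<and> length p = l})"
proof -
  define W where "W = (\<Union>i<n. {p. awalk (f i) p (f i) \<and> length p = l})"
  have finW: "finite W"
    unfolding W_def by (rule finite_subset[OF _ finite_arc_lists[of l]]) auto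
  have "\<forall>c\<in>dicycles G l. \<exists>p. cycle p \<and> length p = l \<and> set p = c"
    by (auto simp: dicycles_def)
  then obtain h where h: "\<And>c. c \<in> dicycles G l \<Longrightarrow> cycle (h c) \<and> length (h c) = l \<and> set (h c) = c"
    by metis
  \<comment> \<open>The set of arcs of the rotated list recovers \<open>c\<close>; its first arc
    then recovers \<open>k\<close>, because the arcs of a cycle are distinct.\<close>
  have "inj_on (\<lambda>(c, k). rotate k (h c)) (dicycles G l \<times> {..<l})"
  proof (rule inj_onI)
    fix x y
    assume xy: "x \<in> dicycles G l \<times> {..<l}" "y \<in> dicycles G l \<times> {..<l}"
      and "(\<lambda>(c, k). rotate k (h c)) x = (\<lambda>(c, k). rotate k (h c)) y"
    then obtain c k c' k' where x: "x = (c, k)" and y: "y = (c', k')"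
      and eq: "rotate k (h c) = rotate k' (h c')" by (cases x; cases y) auto
    hence c: "c \<in> dicycles G l" "c' \<in> dicycles G l" and k: "k < l" "k' < l"
      using xy by auto
    have "c = c'" using arg_cong[OF eq, of set] h c by auto
    moreover have "distinct (h c)" using h[OF c(1)] by (auto simp: cycle_conv)
    moreover have "h c ! (k mod l) = h c ! (k' mod l)"
      using arg_cong[OF eq, of hd] h[OF c(1)] k \<open>c = c'\<close>
      by (metis hd_rotate_conv_nth cycle_conv)
    ultimately show "x = y"
      using h[OF c(1)] k by (auto simp: x y nth_eq_iff_index_eq)
  qed
  moreover have "(\<lambda>(c, k). rotate k (h c)) ` (dicycles G l \<times> {..<l}) \<subseteq> W"
  proof clarify
    fix c k assume c: "c \<in> dicycles G l"
    obtain u where "awalk u (h c) u" using h[OF c] by (auto simp: cycle_conv)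
    then obtain v where v: "awalk v (rotate k (h c)) v"
      using rotate_closed_awalk by blast
    hence "v \<in> pverts G" using awalk_hd_in_verts by auto
    then obtain i where "i < n" "v = f i" using f by (auto simp: bij_betw_def)
    thus "rotate k (h c) \<in> W" using v h[OF c] by (auto simp: W_def)
  qed
  ultimately have "card (dicycles G l \<times> {..<l}) \<le> card W"
    using finW by (rule card_inj_on_le)
  also have "\<dots> \<le> (\<Sum>i<n. card {p. awalk (f i) p (f i) \<and> length p = l})"
    unfolding W_def by (intro card_UN_le) auto
  finally show ?thesis by (simp add: card_cartesian_product mult.commute)
qed

lemma (in tournament) card_dicycles_upper:
  assumes l: "\<not> 4 dvd l"
  shows "real l * real (card (dicycles G l)) \<le> (real (card (pverts G)) / 2) ^ l"
proof -
  define n where "n = card (pverts G)"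
  obtain f where f: "bij_betw f {..<n} (pverts G)"
    using ex_bij_betw_nat_finite[OF pair_finite_verts] by (auto simp: n_def lessThan_atLeast0)
  define A :: "real mat" where
    "A = mat n n (\<lambda>(i, j). if i = j then 1 / 2 else if (f i, f j) \<in> parcs G then 1 else 0)"
  have A: "A \<in> carrier_mat n n" by (simp add: A_def)
  have fv: "f i \<in> pverts G" if "i < n" for i using f that by (auto simp: bij_betw_def)
  have fi: "f i = f j \<longleftrightarrow> i = j" if "i < n" "j < n" for i j
    using f that by (auto simp: bij_betw_def inj_on_def)
  have nonneg: "A $$ (i, j) \<ge> 0" if "i < n" "j < n" for i j
    using that by (simp add: A_def)
  have sum1: "A $$ (i, j) + A $$ (j, i) = 1" if "i < n" "j < n" for i j
    using that orientation[of "f i" "f j"] fv fi by (simp add: A_def)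
  \<comment> \<open>A tournament has no loops, so an arc never meets a diagonal entry 1/2.\<close>
  have arc: "A $$ (i, j) \<ge> 1" if "i < n" "j < n" "(f i, f j) \<in> parcs G" for i j
    using that no_loops' by (auto simp: A_def)
  have "real l * real (card (dicycles G l)) \<le> (\<Sum>i<n. real (card {p. awalk (f i) p (f i) \<and> length p = l}))"
    using dicycles_le_closed_walks[OF f, of l]
    unfolding of_nat_sum[symmetric] of_nat_mult[symmetric] of_nat_le_iff .
  also have "\<dots> \<le> (\<Sum>i<n. (A ^\<^sub>m l) $$ (i, i))"
    using card_walks_le_pow[OF f A nonneg arc] by (intro sum_mono) auto
  also have "\<dots> = trace_mat (A ^\<^sub>m l)"
    using A by (simp add: trace_mat_def)
  also have "\<dots> \<le> (real n / 2) ^ l"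
    by (rule trace_pow_le[OF A sum1 nonneg l])
  finally show ?thesis by (simp add: n_def)
qed

section \<open>Averaging over all tournaments\<close>

text \<open>A cyclic vertex sequence is turned into an arc set, the form in which
  \<open>dicycles\<close> records cycles, so its rotations are identified.\<close>

definition cycle_arcs :: "'a list \<Rightarrow> 'a rel" where
  "cycle_arcs xs = set (zip xs (rotate1 xs))"

lemma mem_cycle_arcs:
  "(a, b) \<in> cycle_arcs xs \<longleftrightarrow> (\<exists>i<length xs. a = xs ! i \<and> b = xs ! (Suc i mod length xs))"
  by (auto simp: cycle_arcs_def in_set_zip nth_rotate1)

lemma card_cycle_arcs_le: "card (cycle_arcs xs) \<le> length xs"
  unfolding cycle_arcs_def by (rule order_trans[OF card_length]) simp

text \<open>Opposite arcs would join positions that are each the cyclic successor of the other,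
  forcing the length to divide 2.\<close>

lemma cycle_arcs_antisym:
  assumes "distinct xs" "length xs \<ge> 3" "(a, b) \<in> cycle_arcs xs"
  shows "(b, a) \<notin> cycle_arcs xs"
proof
  let ?l = "length xs"
  assume "(b, a) \<in> cycle_arcs xs"
  then obtain j where j: "j < ?l" "b = xs ! j" "a = xs ! (Suc j mod ?l)"
    by (auto simp: mem_cycle_arcs)
  obtain i where i: "i < ?l" "a = xs ! i" "b = xs ! (Suc i mod ?l)"
    using assms by (auto simp: mem_cycle_arcs)
  have lt: "Suc j mod ?l < ?l" "Suc i mod ?l < ?l" using i by (auto intro: mod_less_divisor)
  have "j = Suc i mod ?l" "i = Suc j mod ?l"
    using i j lt assms(1) by (metis nth_eq_iff_index_eq)+
  moreover have "Suc k mod ?l = 0 \<and> Suc k = ?l \<or> Suc k mod ?l = Suc k" if "k < ?l" for k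
    using that by (simp add: mod_Suc)
  ultimately have "j = 0 \<and> Suc i = ?l \<or> j = Suc i" "i = 0 \<and> Suc j = ?l \<or> i = Suc j"
    using i(1) j(1) by metis+
  thus False using assms(2) by presburger
qed

text \<open>In a distinct sequence the arc set determines each entry's successor, so the head
  determines the rest. Hence one cycle arises from at most as many sequences as it has
  vertices.\<close>

lemma cycle_arcs_inj:
  assumes "distinct xs" "distinct ys" "length xs = length ys"
    and eq: "cycle_arcs xs = cycle_arcs ys" and hd: "hd xs = hd ys"
  shows "xs = ys"
proof (rule nth_equalityI[OF assms(3)])
  fix k assume "k < length xs"
  thus "xs ! k = ys ! k"
  proof (induction k)
    case 0
    with hd assms(3) show ?case by (metis hd_conv_nth length_greater_0_conv)
  next
    case (Suc k)
    hence IH: "xs ! k = ys ! k" by simp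
    have "(xs ! k, xs ! Suc k) \<in> cycle_arcs xs"
      using Suc.prems by (auto simp: mem_cycle_arcs intro!: exI[of _ k])
    then obtain m where m: "m < length ys" "xs ! k = ys ! m" "xs ! Suc k = ys ! (Suc m mod length ys)"
      unfolding eq by (auto simp: mem_cycle_arcs)
    have "m = k"
      using m IH Suc.prems assms by (metis Suc_lessD nth_eq_iff_index_eq)
    thus ?case using m Suc.prems assms(3) by simp
  qed
qed

lemma (in tournament) cycle_arcs_in_dicycles:
  assumes xs: "distinct xs" "xs \<noteq> []" and sub: "cycle_arcs xs \<subseteq> parcs G"
  shows "cycle_arcs xs \<in> dicycles G (length xs)"
proof -
  obtain x ys where x: "xs = x # ys" using xs(2) by (cases xs) auto
  define p where "p = zip xs (rotate1 xs)"
  have p: "set p = cycle_arcs xs" "length p = length xs" "p \<noteq> []"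
    by (auto simp: p_def cycle_arcs_def x)
  \<comment> \<open>Opening the cycle at its first vertex makes induction possible: the end point
    \<open>z\<close> stays fixed while the start varies, and \<open>z = u\<close> closes the walk
    again.\<close>
  have cas: "cas u (zip (u # zs) (zs @ [z])) z" for u z zs
    by (induction zs arbitrary: u) auto
  have verts: "awalk_verts u (zip (u # zs) (zs @ [z])) = u # zs @ [z]" for u z zs
    by (induction zs arbitrary: u) auto
  have p': "p = zip (x # ys) (ys @ [x])" by (simp add: p_def x)
  have "hd p \<in> parcs G" using p sub by (metis hd_in_set subsetD)
  moreover have "fst (hd p) = x" by (cases ys) (auto simp: p')
  ultimately have "x \<in> pverts G" by (metis in_arcsD1 prod.collapse)
  hence "awalk x p x"
    using sub p cas[of x ys x] by (auto simp: awalk_def p')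
  moreover have "distinct (tl (awalk_verts x p))"
    using xs verts[of x ys x] by (auto simp: p' x)
  ultimately have "cycle p" using p unfolding cycle_def by blast
  thus ?thesis using p unfolding dicycles_def by fastforce
qed

section \<open>Tournaments on \<open>{..<n}\<close> and the average number of cycles\<close>

definition forward_pairs :: "nat \<Rightarrow> nat rel" where
  "forward_pairs n = {(i, j). i < j \<and> j < n}"

text \<open>A subset \<open>S\<close> of the forward pairs lists the pairs oriented upwards. A
  uniformly random tournament thus becomes a uniformly random subset.\<close>

definition tournament_of :: "nat \<Rightarrow> nat rel \<Rightarrow> nat pair_pre_digraph" where
  "tournament_of n S = \<lparr>pverts = {..<n}, parcs = S \<union> (forward_pairs n - S)\<inverse>\<rparr>"

lemma finite_forward_pairs: "finite (forward_pairs n)"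
  by (rule finite_subset[of _ "{..<n} \<times> {..<n}"]) (auto simp: forward_pairs_def)

lemma tournament_of:
  assumes "S \<subseteq> forward_pairs n"
  shows "tournament (tournament_of n S)"
proof -
  have S: "a < b" "a < n" "b < n" if "(a, b) \<in> S" for a b
    using assms that by (auto simp: forward_pairs_def)
  show ?thesis
  proof
    show "finite (parcs (tournament_of n S))"
      using assms finite_forward_pairs[of n] by (auto simp: tournament_of_def intro: finite_subset)
    show "(u, v) \<in> parcs (tournament_of n S) \<longleftrightarrow> (v, u) \<notin> parcs (tournament_of n S)"
      if "u \<in> pverts (tournament_of n S)" "v \<in> pverts (tournament_of n S)" "u \<noteq> v" for u v
      using that S(1)[of u v] S(1)[of v u] by (auto simp: tournament_of_def forward_pairs_def)
  qed (auto simp: tournament_of_def forward_pairs_def dest: S)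
qed

text \<open>A random tournament contains \<open>c\<close> with probability at least 2^(-|c|), stated
  without division: the arcs of \<open>c\<close> prescribe the orientation of at most |c| pairs, and
  all other pairs are free.\<close>

lemma many_tournaments_contain:
  assumes c: "c \<subseteq> {..<n} \<times> {..<n}" and anti: "\<And>a b. (a, b) \<in> c \<Longrightarrow> (b, a) \<notin> c"
  shows "2 ^ card (forward_pairs n) \<le> 2 ^ card c * card {S \<in> Pow (forward_pairs n). c \<subseteq> parcs (tournament_of n S)}"
proof -
  let ?E = "forward_pairs n"
  \<comment> \<open>\<open>P\<close> collects the pairs that must belong to \<open>S\<close>, and
    \<open>Q\<close> those that must stay out of it, because \<open>c\<close> uses them
    downwards.\<close>
  define P where "P = c \<inter> ?E"
  define Q where "Q = c\<inverse> \<inter> ?E"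
  have finc: "finite c" using c by (rule finite_subset) simp
  have dis: "P \<inter> Q = {}" using anti by (auto simp: P_def Q_def)
  have c_eq: "c \<subseteq> P \<union> Q\<inverse>"
  proof (rule subrelI)
    fix a b assume ab: "(a, b) \<in> c"
    hence "a \<noteq> b" using anti by auto
    hence "a < b \<or> b < a" by auto
    thus "(a, b) \<in> P \<union> Q\<inverse>" using ab c by (auto simp: P_def Q_def forward_pairs_def)
  qed
  have "card (P \<union> Q) \<le> card c"
  proof -
    have fin: "finite P" "finite Q" using finc by (auto simp: P_def Q_def)
    have "P \<inter> Q\<inverse> = {}" by (auto simp: P_def Q_def forward_pairs_def)
    hence "card (P \<union> Q) = card (P \<union> Q\<inverse>)"
      using dis fin by (simp add: card_Un_disjoint)
    also have "\<dots> \<le> card c"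
      using finc by (intro card_mono) (auto simp: P_def Q_def)
    finally show ?thesis .
  qed
  hence "card ?E \<le> card c + card (?E - (P \<union> Q))"
    using diff_card_le_card_Diff[of "P \<union> Q" ?E] finc by (simp add: P_def Q_def)
  hence "2 ^ card ?E \<le> (2 :: nat) ^ (card c + card (?E - (P \<union> Q)))"
    by (intro power_increasing) auto
  also have "\<dots> = 2 ^ card c * card (Pow (?E - (P \<union> Q)))"
    using finite_forward_pairs[of n] by (simp add: power_add card_Pow)
  also have "\<dots> \<le> 2 ^ card c * card {S \<in> Pow ?E. c \<subseteq> parcs (tournament_of n S)}"
  \<comment> \<open>Every choice on the free pairs, completed by \<open>P\<close>, gives a
    tournament containing \<open>c\<close>.\<close>
  proof (intro mult_left_mono card_inj_on_le[where f = "\<lambda>S. S \<union> P"])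
    show "inj_on (\<lambda>S. S \<union> P) (Pow (?E - (P \<union> Q)))"
      by (rule inj_onI) blast
    have "c \<subseteq> parcs (tournament_of n (S \<union> P))" if "S \<subseteq> ?E - (P \<union> Q)" for S
    proof -
      have "Q \<subseteq> ?E - (S \<union> P)" using that dis by (auto simp: Q_def)
      thus ?thesis using c_eq by (auto simp: tournament_of_def)
    qed
    thus "(\<lambda>S. S \<union> P) ` Pow (?E - (P \<union> Q)) \<subseteq> {S \<in> Pow ?E. c \<subseteq> parcs (tournament_of n S)}"
      by (auto simp: P_def)
  qed (use finite_forward_pairs[of n] in auto)
  finally show ?thesis .
qed

lemma card_distinct_lists:
  assumes "l \<le> n"
  shows "card {xs. length xs = l \<and> distinct xs \<and> set xs \<subseteq> {..<n :: nat}} = fact l * (n choose l)"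
proof -
  have "card {xs. length xs = l \<and> distinct xs \<and> set xs \<subseteq> {..<n :: nat}} = \<Prod>{n - l + 1..n}"
    using assms by (simp add: card_lists_distinct_length_eq)
  also have "\<dots> = fact n div fact (n - l)"
    using fact_div_fact[of "n - l" n] by simp
  also have "\<dots> = fact l * (n choose l)"
    using binomial_fact_lemma[OF assms] by (metis fact_nonzero mult.assoc mult.commute nonzero_mult_div_cancel_left)
  finally show ?thesis .
qed

text \<open>The maximum is at least the average over all \<open>2 ^ card ?E\<close> orientations,
  found by counting pairs of a possible cycle and a tournament containing it. The number of possible
  cycles is at least the number of distinct sequences divided by \<open>l\<close>.\<close>

lemma max_dicycles_lower:
  assumes l: "l \<ge> 3" "l \<le> n"
  shows "fact l * (n choose l) \<le> l * 2 ^ l * max_dicycles n l"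
proof -
  let ?E = "forward_pairs n"
  define L where "L = {xs. length xs = l \<and> distinct xs \<and> set xs \<subseteq> {..<n}}"
  define C where "C = cycle_arcs ` L"
  have finL: "finite L"
    unfolding L_def by (rule finite_subset[OF _ finite_lists_length_eq[of "{..<n}" l]]) auto
  hence finC: "finite C" by (simp add: C_def)
  have card_c: "finite c \<and> card c \<le> l" if "c \<in> C" for c
    using that card_cycle_arcs_le by (auto simp: C_def L_def cycle_arcs_def)
  \<comment> \<open>A sequence is encoded by its arc set and its starting vertex, and an arc set in
    \<open>C\<close> offers at most \<open>l\<close> starting vertices.\<close>
  have "card L \<le> card (Sigma C Domain)"
  proof (rule card_inj_on_le[where f = "\<lambda>xs. (cycle_arcs xs, hd xs)"])
    show "inj_on (\<lambda>xs. (cycle_arcs xs, hd xs)) L"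
      by (rule inj_onI) (auto simp: L_def intro: cycle_arcs_inj)
    have "hd xs \<in> Domain (cycle_arcs xs)" if "xs \<in> L" for xs
      using that l by (cases xs) (auto simp: L_def mem_cycle_arcs intro!: DomainI[of _ "xs ! (1 mod l)"] exI[of _ 0])
    thus "(\<lambda>xs. (cycle_arcs xs, hd xs)) ` L \<subseteq> Sigma C Domain"
      by (auto simp: C_def)
    show "finite (Sigma C Domain)"
      using finC card_c by (auto intro!: finite_SigmaI finite_Domain)
  qed
  also have "\<dots> = (\<Sum>c\<in>C. card (Domain c))"
    using finC card_c by (intro card_SigmaI) (auto intro: finite_Domain)
  also have "\<dots> \<le> (\<Sum>c\<in>C. l)"
  proof (intro sum_mono)
    fix c assume "c \<in> C"
    thus "card (Domain c) \<le> l"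
      using card_c card_image_le[of c fst] by (fastforce simp: Domain_fst)
  qed
  finally have "fact l * (n choose l) \<le> l * card C"
    using card_distinct_lists[OF l(2)] by (simp add: L_def mult.commute)
  also have "l * card C \<le> l * 2 ^ l * max_dicycles n l"
  proof -
    have "card C \<le> 2 ^ l * max_dicycles n l"
    proof -
      let ?T = "tournament_of n"
      have finE: "finite (Pow ?E)" using finite_forward_pairs by simp
      have "card C * 2 ^ card ?E = (\<Sum>c\<in>C. 2 ^ card ?E)" by simp
      also have "\<dots> \<le> (\<Sum>c\<in>C. 2 ^ l * card {S \<in> Pow ?E. c \<subseteq> parcs (?T S)})"
      proof (intro sum_mono)
        fix c assume c: "c \<in> C"
        then obtain xs where xs: "c = cycle_arcs xs" "xs \<in> L" by (auto simp: C_def)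
        have "2 ^ card ?E \<le> 2 ^ card c * card {S \<in> Pow ?E. c \<subseteq> parcs (?T S)}"
        proof (rule many_tournaments_contain)
          show "c \<subseteq> {..<n} \<times> {..<n}"
          proof clarify
            fix a b assume "(a, b) \<in> c"
            then obtain i where i: "i < length xs" "a = xs ! i" "b = xs ! (Suc i mod length xs)"
              unfolding xs by (auto simp: mem_cycle_arcs)
            moreover have "Suc i mod length xs < length xs"
              using i(1) by (intro mod_less_divisor) auto
            ultimately have "a \<in> set xs" "b \<in> set xs" by auto
            thus "a \<in> {..<n} \<and> b \<in> {..<n}" using xs by (auto simp: L_def)
          qed
          show "(b, a) \<notin> c" if "(a, b) \<in> c" for a b
            using that xs l cycle_arcs_antisym[of xs a b] by (auto simp: L_def)
        qed
        also have "\<dots> \<le> 2 ^ l * card {S \<in> Pow ?E. c \<subseteq> parcs (?T S)}"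
          using card_c[OF c] by (intro mult_right_mono power_increasing) auto
        finally show "2 ^ card ?E \<le> 2 ^ l * card {S \<in> Pow ?E. c \<subseteq> parcs (?T S)}" .
      qed
      also have "\<dots> = 2 ^ l * (\<Sum>c\<in>C. card {S \<in> Pow ?E. c \<subseteq> parcs (?T S)})"
        by (simp add: sum_distrib_left)
      \<comment> \<open>Double counting: from tournaments per cycle to cycles per
        tournament.\<close>
      also have "(\<Sum>c\<in>C. card {S \<in> Pow ?E. c \<subseteq> parcs (?T S)}) =
          (\<Sum>S\<in>Pow ?E. card {c \<in> C. c \<subseteq> parcs (?T S)})"
        using finE finC by (intro sum_multicount_gen) auto
      also have "\<dots> \<le> (\<Sum>S\<in>Pow ?E. max_dicycles n l)"
      proof (intro sum_mono)
        fix S assume "S \<in> Pow ?E"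
        hence T: "tournament (?T S)" by (intro tournament_of) auto
        have "{c \<in> C. c \<subseteq> parcs (?T S)} \<subseteq> dicycles (?T S) l"
          using tournament.cycle_arcs_in_dicycles[OF T] l by (fastforce simp: C_def L_def)
        moreover have "finite (dicycles (?T S) l)"
        proof -
          interpret tournament "?T S" by (rule T)
          show ?thesis using dicycles_subset by (rule finite_subset) simp
        qed
        ultimately have "card {c \<in> C. c \<subseteq> parcs (?T S)} \<le> card (dicycles (?T S) l)"
          by (intro card_mono)
        also have "\<dots> \<le> max_dicycles n l"
          unfolding max_dicycles_def
          using T by (intro Max_ge finite_dicycle_counts) (auto simp: tournament_of_def)
        finally show "card {c \<in> C. c \<subseteq> parcs (?T S)} \<le> max_dicycles n l" .
      qed
      finally show ?thesis
        using finite_forward_pairs[of n] by (simp add: card_Pow)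
    qed
    thus ?thesis unfolding mult.assoc by (rule mult_le_mono2)
  qed
  finally show ?thesis .
qed

lemma max_dicycles_upper:
  assumes "\<not> 4 dvd l"
  shows "real l * real (max_dicycles n l) \<le> (real n / 2) ^ l"
proof -
  have "max_dicycles n l \<in> {card (dicycles G l) |G :: nat pair_pre_digraph. tournament G \<and> card (pverts G) = n}"
    unfolding max_dicycles_def by (intro Max_in finite_dicycle_counts dicycle_counts_nonempty)
  then obtain G :: "nat pair_pre_digraph" where
    "max_dicycles n l = card (dicycles G l)" "tournament G" "card (pverts G) = n" by auto
  thus ?thesis using tournament.card_dicycles_upper[OF _ assms, of G] by simp
qed

section \<open>The limit\<close>

text \<open>The denominator is the falling factorial of \<open>n\<close> with \<open>l\<close>
  factors, so the quotient is a product of a fixed number of factors tending to 1.\<close>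

lemma power_over_falling_tendsto_1:
  "(\<lambda>n. real n ^ l / (fact l * real (n choose l))) \<longlonglongrightarrow> 1"
proof -
  have "(\<lambda>n. \<Prod>i<l. real n / (real n - real i)) \<longlonglongrightarrow> (\<Prod>i<l. 1)"
  proof (intro tendsto_prod)
    show "(\<lambda>n. real n / (real n - real i)) \<longlonglongrightarrow> 1" for i by real_asymp
  qed
  \<comment> \<open>This also holds for \<open>n < l\<close>: the factor \<open>i = n\<close> and
    the right side are both divisions by zero, with value 0.\<close>
  moreover have "(\<Prod>i<l. real n / (real n - real i)) = real n ^ l / (fact l * real (n choose l))" for n
    by (simp add: prod_dividef binomial_gbinomial gbinomial_prod_rev lessThan_atLeast0)
  ultimately show ?thesis by simp
qed

theorem theorem2:
  fixes l :: nat
  assumes "l \<ge> 3" and "\<not> 4 dvd l"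
  shows "convergent (dicycle_ratio l) \<and> cycle_limit l = 1"
proof -
  \<comment> \<open>Extending the fraction by \<open>l\<close> turns \<open>fact (l - 1)\<close>
    into \<open>fact l\<close>, the normalisation shared by both bounds.\<close>
  have ratio: "dicycle_ratio l n = real (l * 2 ^ l * max_dicycles n l) / real (fact l * (n choose l))" for n
  proof -
    have "fact l = real l * fact (l - 1)" using assms(1) by (simp add: fact_reduce)
    thus ?thesis
      using assms(1) unfolding dicycle_ratio_def expected_dicycles_def by simp
  qed
  have "dicycle_ratio l \<longlonglongrightarrow> 1"
  \<comment> \<open>Averaging gives the lower bound 1 once \<open>l \<le> n\<close>, where the
    binomial coefficient is positive; the trace bound gives the upper estimate.\<close>
  proof (rule tendsto_sandwich[OF _ _ tendsto_const power_over_falling_tendsto_1[of l]])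
    show "\<forall>\<^sub>F n in sequentially. 1 \<le> dicycle_ratio l n"
      using eventually_ge_at_top[of l]
    proof eventually_elim
      case (elim n)
      have "real (fact l * (n choose l)) \<le> real (l * 2 ^ l * max_dicycles n l)"
        using max_dicycles_lower[OF assms(1) elim] by (simp only: of_nat_le_iff)
      thus ?case
        unfolding ratio using elim by (subst le_divide_eq_1_pos) (auto simp del: of_nat_mult of_nat_fact)
    qed
    show "\<forall>\<^sub>F n in sequentially. dicycle_ratio l n \<le> real n ^ l / (fact l * real (n choose l))"
    proof (intro always_eventually allI)
      fix n
      have "real (l * 2 ^ l * max_dicycles n l) \<le> real n ^ l"
        using max_dicycles_upper[OF assms(2), of n] by (simp add: power_divide field_simps)
      thus "dicycle_ratio l n \<le> real n ^ l / (fact l * real (n choose l))"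
        unfolding ratio by (auto intro!: divide_right_mono)
    qed
  qed
  thus ?thesis
    unfolding cycle_limit_def using limI convergentI by blast
qed

end
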